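(* In the simple game modeling the US legislative system, let $P$ be the president, $V$ the vice president, $S$ a senator and $R$ a representative. Then $P\succ S\succ R$ and $S\succeq V$. It follows that: (a) for any power index $\Phi$ for which $\Phi(P)\ne 0$ and $\Phi(S)\ne 0$, we have $\Phi(P)>\Phi(S)>\Phi(R)$ and $\Phi(S)\ge\Phi(V)$; (b) if $\Phi$ is the Banzhaf or the Shapley-Shubik index, then $\Phi(P)>\Phi(S)>\Phi(V)>\Phi(R)$.
   Context: The simple game modeling the US legislative system has $n=537$ players: the president, the vice president, 100 senators and 435 representatives. The "full Senate" is the 101-element set consisting of the 100 senators and the vice president. The minimal winning coalitions are of two types: (I) the president, 51 members of the full Senate, and 218 representatives; (II) 67 senators (the vice president does not count here) and 290 representatives. A coalition (set of players) is winning iff it contains a coalition of type I or II. A player $i$ in a coalition $T$ is critical in $T$ if $T$ is winning and $T\setminus\{i\}$ is not. For a player $i$, $c_i(k)$ is the number of coalitions of size $k$ in which $i$ is critical. For players $i,j$: $i\succeq j$ means $c_i(k)\ge c_j(k)$ for all $1\le k\le n$; $i\succ j$ means $c_i(k)>c_j(k)$ for all $k$ such that $c_i(k)$ and $c_j(k)$ are not both zero. A power index $\Phi$ is given by a weighting vector $(\lambda_1,\dots,\lambda_n)$ with $\lambda_k\ge0$ and $\sum_{k=1}^n\lambda_k\binom{n-1}{k-1}=1$, with $\Phi(i)=\sum_{k=1}^n\lambda_kc_i(k)$. The Banzhaf index has $\lambda_k=1/2^{n-1}$ and the Shapley-Shubik index has $\lambda_k=1/\left(n\binom{n-1}{k-1}\right)$.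 *)

theory Defs
  imports Complex_Main
begin

text \<open>A game is given by its set of players \<open>N\<close> and a predicate \<open>W\<close> which says which
  coalitions (subsets of \<open>N\<close>) are winning; throughout, \<open>n = card N\<close>.\<close>

definition critical :: "('a set \<Rightarrow> bool) \<Rightarrow> 'a set \<Rightarrow> 'a \<Rightarrow> bool" where
  "critical W T i \<longleftrightarrow> i \<in> T \<and> W T \<and> \<not> W (T - {i})"

definition crit_count :: "'a set \<Rightarrow> ('a set \<Rightarrow> bool) \<Rightarrow> 'a \<Rightarrow> nat \<Rightarrow> nat" where
  "crit_count N W i k = card {T. T \<subseteq> N \<and> card T = k \<and> critical W T i}"

definition weakly_dominates :: "'a set \<Rightarrow> ('a set \<Rightarrow> bool) \<Rightarrow> 'a \<Rightarrow> 'a \<Rightarrow> bool" where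
  "weakly_dominates N W i j \<longleftrightarrow>
     (\<forall>k\<in>{1..card N}. crit_count N W i k \<ge> crit_count N W j k)"

definition strictly_dominates :: "'a set \<Rightarrow> ('a set \<Rightarrow> bool) \<Rightarrow> 'a \<Rightarrow> 'a \<Rightarrow> bool" where
  "strictly_dominates N W i j \<longleftrightarrow>
     (\<forall>k\<in>{1..card N}. \<not> (crit_count N W i k = 0 \<and> crit_count N W j k = 0)
        \<longrightarrow> crit_count N W i k > crit_count N W j k)"

definition weighting :: "nat \<Rightarrow> (nat \<Rightarrow> real) \<Rightarrow> bool" where
  "weighting n lam \<longleftrightarrow>
     (\<forall>k\<in>{1..n}. lam k \<ge> 0) \<and> (\<Sum>k=1..n. lam k * real ((n - 1) choose (k - 1))) = 1"

definition index_of :: "'a set \<Rightarrow> ('a set \<Rightarrow> bool) \<Rightarrow> (nat \<Rightarrow> real) \<Rightarrow> 'a \<Rightarrow> real" where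
  "index_of N W lam i = (\<Sum>k=1..card N. lam k * real (crit_count N W i k))"

definition power_index :: "'a set \<Rightarrow> ('a set \<Rightarrow> bool) \<Rightarrow> ('a \<Rightarrow> real) \<Rightarrow> bool" where
  "power_index N W \<Phi> \<longleftrightarrow> (\<exists>lam. weighting (card N) lam \<and> \<Phi> = index_of N W lam)"

definition banzhaf :: "'a set \<Rightarrow> ('a set \<Rightarrow> bool) \<Rightarrow> 'a \<Rightarrow> real" where
  "banzhaf N W = index_of N W (\<lambda>k. 1 / 2 ^ (card N - 1))"

definition shapley_shubik :: "'a set \<Rightarrow> ('a set \<Rightarrow> bool) \<Rightarrow> 'a \<Rightarrow> real" where
  "shapley_shubik N W =
     index_of N W (\<lambda>k. 1 / (real (card N) * real ((card N - 1) choose (k - 1))))"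

lemma sum_choose_shift:
  fixes f :: "nat \<Rightarrow> real" and n :: nat
  assumes "n \<ge> 1"
  shows "(\<Sum>k=1..n. f (k - 1)) = (\<Sum>j\<le>n - 1. f j)"
  by (rule sum.reindex_bij_witness[of _ Suc "\<lambda>k. k - 1"]) (use assms in auto)

lemma power_index_banzhaf:
  assumes "card N \<ge> 1"
  shows "power_index N W (banzhaf N W)"
proof -
  let ?n = "card N"
  have "(\<Sum>k=1..?n. 1 / 2 ^ (?n - 1) * real ((?n - 1) choose (k - 1)))
      = (\<Sum>j\<le>?n - 1. 1 / 2 ^ (?n - 1) * real ((?n - 1) choose j))"
    using sum_choose_shift[OF assms, of "\<lambda>j. 1 / 2 ^ (?n - 1) * real ((?n - 1) choose j)"] .
  also have "\<dots> = 1 / 2 ^ (?n - 1) * real (\<Sum>j\<le>?n - 1. (?n - 1) choose j)"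
    by (simp add: sum_distrib_left)
  also have "\<dots> = 1"
    by (simp add: choose_row_sum)
  finally have "weighting ?n (\<lambda>k. 1 / 2 ^ (?n - 1))"
    unfolding weighting_def by simp
  then show ?thesis
    unfolding power_index_def banzhaf_def by blast
qed

lemma power_index_shapley_shubik:
  assumes "card N \<ge> 1"
  shows "power_index N W (shapley_shubik N W)"
proof -
  let ?n = "card N"
  have "(\<Sum>k=1..?n. 1 / (real ?n * real ((?n - 1) choose (k - 1))) * real ((?n - 1) choose (k - 1)))
      = (\<Sum>k=1..?n. 1 / real ?n)"
    by (rule sum.cong) (use assms in auto)
  also have "\<dots> = 1"
    using assms by simp
  finally have "weighting ?n (\<lambda>k. 1 / (real ?n * real ((?n - 1) choose (k - 1))))"
    unfolding weighting_def by simp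
  then show ?thesis
    unfolding power_index_def shapley_shubik_def by blast
qed

text \<open>The type is infinite; the 537 players are the elements of \<open>players\<close>.\<close>

datatype player = President | VicePresident | Senator nat | Representative nat

definition senators :: "player set" where
  "senators = Senator ` {..<100}"

definition representatives :: "player set" where
  "representatives = Representative ` {..<435}"

definition full_senate :: "player set" where
  "full_senate = insert VicePresident senators"

definition players :: "player set" where
  "players = {President, VicePresident} \<union> senators \<union> representatives"

definition type_I :: "player set \<Rightarrow> bool" where
  "type_I T \<longleftrightarrow> (\<exists>A B. A \<subseteq> full_senate \<and> card A = 51 \<and> B \<subseteq> representatives \<and> card B = 218
     \<and> T = {President} \<union> A \<union> B)"

definition type_II :: "player set \<Rightarrow> bool" where
  "type_II T \<longleftrightarrow> (\<exists>A B. A \<subseteq> senators \<and> card A = 67 \<and> B \<subseteq> representatives \<and> card B = 290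
     \<and> T = A \<union> B)"

definition winning :: "player set \<Rightarrow> bool" where
  "winning T \<longleftrightarrow> T \<subseteq> players \<and> (\<exists>U\<subseteq>T. type_I U \<or> type_II U)"

lemma card_players: "card players = 537"
proof -
  have s: "finite senators" "card senators = 100"
    by (auto simp: senators_def card_image inj_on_def)
  have r: "finite representatives" "card representatives = 435"
    by (auto simp: representatives_def card_image inj_on_def)
  let ?U = "senators \<union> representatives"
  have U: "card ?U = 535" "finite ?U"
    using s r by (subst card_Un_disjoint) (auto simp: senators_def representatives_def)
  have "VicePresident \<notin> ?U"
    by (auto simp: senators_def representatives_def)
  then have "card (insert VicePresident ?U) = 536"
    using card_insert_disjoint[OF U(2)] U(1) by simp
  moreover have "President \<notin> insert VicePresident ?U"
    by (auto simp: senators_def representatives_def)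
  moreover have "insert President (insert VicePresident ?U) = players"
    by (auto simp: players_def)
  ultimately show ?thesis
    using card_insert_disjoint[of "insert VicePresident ?U" President] U(2) by simp
qed

end

theory Submission
  imports Defs
begin

text \<open>Exchanging a senator for the president embeds the coalitions critical for the senator properly
  into those critical for the president, so the first domination needs no counting. For the others the
  critical coalitions of fixed size are counted by products of binomial coefficients. As
  functions of the size, the counts for the senator (or vice president) and the representative have
  ratios of consecutive terms that compare in one direction, so each inequality propagates from the
  smallest relevant size. The vice president does not dominate a representative: without the
  president, a representative can be critical and the vice president cannot. For the Banzhaf and
  Shapley-Shubik indices this deficit, which starts at size 357, is absorbed by a shift to
  smaller sizes, where the vice president has a surplus.\<close>

section \<open>Inequalities between binomial coefficients\<close>

text \<open>Inductive step for comparing two sequences by their consecutive ratios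
  \<open>x' / x = q / p\<close> and \<open>y' / y = q' / p'\<close>, cross-multiplied to stay within
  \<open>nat\<close>. Several base cases use it with \<open>x = y\<close>, a common factor of both
  sides.\<close>

lemma ratio_step:
  fixes x x' y y' p q p' q' :: nat
  assumes "x \<le> y" "x' * p = x * q" "y' * p' = y * q'" "q * p' \<le> q' * p" "p > 0" "p' > 0"
  shows "x' \<le> y'"
proof -
  have "x' * (p * p') = x * (q * p')"
    using assms(2) by (simp flip: mult.assoc)
  also have "\<dots> \<le> y * (q' * p)"
    by (intro mult_mono assms) auto
  also have "\<dots> = y' * (p * p')"
    using assms(3) by (metis mult.assoc mult.commute)
  finally show ?thesis
    using assms(5,6) by simp
qed

text \<open>Combines the ratios of two factors that change at once into the form that
  \<open>ratio_step\<close> expects; the next lemma chains two changes of a single factor.\<close>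

lemma mult_eq_mult_pair:
  fixes x x' y y' p p' q q' c :: "'a::comm_semiring_1"
  assumes "x' * p = x * q" "y' * p' = y * q'"
  shows "c * x' * y' * (p * p') = c * x * y * (q * q')"
proof -
  have "c * x' * y' * (p * p') = c * (x' * p) * (y' * p')"
    by (simp only: mult_ac)
  then show ?thesis
    unfolding assms by (simp only: mult_ac)
qed

lemma mult_eq_mult_trans:
  fixes x x' x'' p p' q q' c :: "'a::comm_semiring_1"
  assumes "x' * p = x * q" "x'' * p' = x' * q'"
  shows "c * x'' * (p' * p) = c * x * (q' * q)"
proof -
  have "c * x'' * (p' * p) = c * (x'' * p') * p"
    by (simp only: mult_ac)
  also have "\<dots> = c * (x' * p) * q'"
    unfolding assms(2) by (simp only: mult_ac)
  finally show ?thesis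
    unfolding assms(1) by (simp only: mult_ac)
qed

lemma binomial_Suc_right: "(n choose Suc k) * Suc k = (n choose k) * (n - k)"
  by (metis binomial_absorb_comp binomial_absorption mult.commute)

text \<open>Iterates \<open>binomial_Suc_right\<close>: the rising factorials are the products of
  \<open>k + 1, ..., k + d\<close> and of \<open>n - k - d + 1, ..., n - k\<close>. It relates
  binomial coefficients with distant lower indices in the base cases.\<close>

lemma binomial_add_right:
  assumes "k + d \<le> n"
  shows "(n choose (k + d)) * pochhammer (Suc k) d = (n choose k) * pochhammer (Suc (n - k - d)) d"
  using assms
proof (induction d)
  case (Suc d)
  have "(n choose (k + Suc d)) * pochhammer (Suc k) (Suc d)
      = (n choose Suc (k + d)) * Suc (k + d) * pochhammer (Suc k) d"
    by (simp add: pochhammer_Suc algebra_simps del: binomial_Suc_Suc)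
  also have "\<dots> = (n choose k) * ((n - (k + d)) * pochhammer (Suc (n - k - d)) d)"
    using Suc by (simp only: binomial_Suc_right) simp
  also have "(n - (k + d)) * pochhammer (Suc (n - k - d)) d = pochhammer (Suc (n - k - Suc d)) (Suc d)"
    using Suc.prems by (simp add: pochhammer_rec Suc_diff_Suc)
  finally show ?case .
qed simp

text \<open>Lets simplification evaluate the concrete rising factorials in the base cases.\<close>

lemma pochhammer_numeral: "pochhammer a (numeral m) = a * pochhammer (a + 1) (pred_numeral m)"
  by (simp add: numeral_eq_Suc pochhammer_rec)

text \<open>The slack factor 199/200 makes the resulting comparison of positive counts strict; it is nearly
  optimal at \<open>t = 0\<close>, where the quotient of the two sides without it is about 0.993.\<close>

lemma rep_le_senator_I:
  assumes "t \<le> 50"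
  shows "200 * ((434 choose 217) * (101 choose (51 + t))) \<le> 199 * ((100 choose 50) * (435 choose (218 + t)))"
  using assms
proof (induction t)
  case 0
  \<comment> \<open>Absorption reduces both sides to the common factor
    \<open>(434 choose 217) * (100 choose 50)\<close>; what remains is
    \<open>200 * 101 * 218 \<le> 199 * 435 * 51\<close>.\<close>
  show ?case
  proof (rule ratio_step[where p = 51 and q = "200 * 101" and p' = 218 and q' = "199 * 435"])
    show "200 * ((434 choose 217) * (101 choose (51 + 0))) * 51 = (434 choose 217) * (100 choose 50) * (200 * 101)"
      using binomial_absorption[of 50 101] by simp
    show "199 * ((100 choose 50) * (435 choose (218 + 0))) * 218 = (434 choose 217) * (100 choose 50) * (199 * 435)"
      using binomial_absorption[of 217 435] by simp
  qed auto
next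
  case (Suc t)
  show ?case
  proof (rule ratio_step[where p = "52 + t" and q = "50 - t" and p' = "219 + t" and q' = "217 - t"])
    show "200 * ((434 choose 217) * (101 choose (51 + t))) \<le> 199 * ((100 choose 50) * (435 choose (218 + t)))"
      using Suc by simp
    show "200 * ((434 choose 217) * (101 choose (51 + Suc t))) * (52 + t) =
      200 * ((434 choose 217) * (101 choose (51 + t))) * (50 - t)"
      using binomial_Suc_right[of 101 "51 + t"] by (simp del: binomial_Suc_Suc)
    show "199 * ((100 choose 50) * (435 choose (218 + Suc t))) * (219 + t) =
      199 * ((100 choose 50) * (435 choose (218 + t))) * (217 - t)"
      using binomial_Suc_right[of 435 "218 + t"] by (simp del: binomial_Suc_Suc)
    \<comment> \<open>Writing 50 as a sum avoids truncated subtraction: \<open>217 - t\<close>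
      becomes \<open>167 + u\<close>, the terms \<open>t * u\<close> cancel, and a linear inequality
      remains.\<close>
    obtain u where "50 = t + u" using Suc.prems by (metis Suc_leD le_Suc_ex)
    then show "(50 - t) * (219 + t) \<le> (217 - t) * (52 + t)"
      by (auto simp: algebra_simps)
  qed auto
qed

text \<open>With \<open>t = k - 282\<close>: a representative's coalitions containing the president
  use up at most a tenth of the vice president's count, which keeps nine tenths free for the shifted
  deficit. For \<open>t > 38\<close> the binomial coefficient on the left vanishes.\<close>

lemma rep_le_vice:
  assumes "t \<le> 38"
  shows "10 * ((434 choose 217) * (101 choose (63 + t))) \<le> (100 choose 50) * (435 choose (230 + t))"
  using assms
proof (induction t)
  case 0
  show ?case
  proof (rule ratio_step[where p = "pochhammer 52 12 * 51" and q = "10 * 101 * pochhammer 39 12"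
        and p' = "pochhammer 219 12 * 218" and q' = "435 * pochhammer 206 12"])
    have "(101 choose 51) * 51 = (100 choose 50) * 101"
      "(101 choose 63) * pochhammer 52 12 = (101 choose 51) * pochhammer 39 12"
      using binomial_absorption[of 50 101] binomial_add_right[of 51 12 101] by (simp_all)
    then show "10 * ((434 choose 217) * (101 choose (63 + 0))) * (pochhammer 52 12 * 51)
        = (434 choose 217) * (100 choose 50) * (10 * 101 * pochhammer 39 12)"
      using mult_eq_mult_trans[of "101 choose 51" 51 "100 choose 50" 101 "101 choose 63" _ _ "10 * (434 choose 217)"] by (simp add: mult_ac)
    have "(435 choose 218) * 218 = (434 choose 217) * 435"
      "(435 choose 230) * pochhammer 219 12 = (435 choose 218) * pochhammer 206 12"
      using binomial_absorption[of 217 435] binomial_add_right[of 218 12 435] by (simp_all)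
    then show "(100 choose 50) * (435 choose (230 + 0)) * (pochhammer 219 12 * 218)
        = (434 choose 217) * (100 choose 50) * (435 * pochhammer 206 12)"
      using mult_eq_mult_trans[of "435 choose 218" 218 "434 choose 217" 435 "435 choose 230" _ _ "100 choose 50"] by (simp add: mult_ac)
  qed (simp_all add: pochhammer_numeral)
next
  case (Suc t)
  show ?case
  proof (rule ratio_step[where p = "64 + t" and q = "38 - t" and p' = "231 + t" and q' = "205 - t"])
    show "10 * ((434 choose 217) * (101 choose (63 + t))) \<le> (100 choose 50) * (435 choose (230 + t))"
      using Suc by simp
    show "10 * ((434 choose 217) * (101 choose (63 + Suc t))) * (64 + t) =
      10 * ((434 choose 217) * (101 choose (63 + t))) * (38 - t)"
      using binomial_Suc_right[of 101 "63 + t"] by (simp del: binomial_Suc_Suc)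
    show "(100 choose 50) * (435 choose (230 + Suc t)) * (231 + t) =
      (100 choose 50) * (435 choose (230 + t)) * (205 - t)"
      using binomial_Suc_right[of 435 "230 + t"] by (simp del: binomial_Suc_Suc)
    obtain u where "38 = t + u" using Suc.prems by (metis Suc_leD le_Suc_ex)
    then show "(38 - t) * (231 + t) \<le> (205 - t) * (64 + t)"
      by (auto simp: algebra_simps)
  qed auto
qed

text \<open>Here \<open>t = k - 358\<close>, starting one above the minimal size
  \<open>357 = 67 + 290\<close> of type II. The upper arguments 101 and 436 come from merging, by
  Pascal's rule, the coalitions with and without the vice president.\<close>

lemma rep_le_senator_II:
  assumes "t \<le> 33"
  shows "200 * ((434 choose 289) * (101 choose (68 + t))) \<le> 199 * ((99 choose 66) * (436 choose (291 + t)))"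
  using assms
proof (induction t)
  case 0
  show ?case
  proof (rule ratio_step[where p = "68 * 67" and q = "200 * 101 * 100" and p' = "291 * 290" and q' = "199 * 436 * 435"])
    have "68 * (101 choose 68) = 101 * (100 choose 67)" "67 * (100 choose 67) = 100 * (99 choose 66)"
      using binomial_absorption[of 67 101] binomial_absorption[of 66 100] by simp_all
    then show "200 * ((434 choose 289) * (101 choose (68 + 0))) * (68 * 67) = (434 choose 289) * (99 choose 66) * (200 * 101 * 100)"
      by simp
    have "291 * (436 choose 291) = 436 * (435 choose 290)" "290 * (435 choose 290) = 435 * (434 choose 289)"
      using binomial_absorption[of 290 436] binomial_absorption[of 289 435] by simp_all
    then show "199 * ((99 choose 66) * (436 choose (291 + 0))) * (291 * 290) = (434 choose 289) * (99 choose 66) * (199 * 436 * 435)"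
      by simp
  qed auto
next
  case (Suc t)
  show ?case
  proof (rule ratio_step[where p = "69 + t" and q = "33 - t" and p' = "292 + t" and q' = "145 - t"])
    show "200 * ((434 choose 289) * (101 choose (68 + t))) \<le> 199 * ((99 choose 66) * (436 choose (291 + t)))"
      using Suc by simp
    show "200 * ((434 choose 289) * (101 choose (68 + Suc t))) * (69 + t) =
      200 * ((434 choose 289) * (101 choose (68 + t))) * (33 - t)"
      using binomial_Suc_right[of 101 "68 + t"] by (simp del: binomial_Suc_Suc)
    show "199 * ((99 choose 66) * (436 choose (291 + Suc t))) * (292 + t) =
      199 * ((99 choose 66) * (436 choose (291 + t))) * (145 - t)"
      using binomial_Suc_right[of 436 "291 + t"] by (simp del: binomial_Suc_Suc)
    obtain u where "33 = t + u" using Suc.prems by (metis Suc_leD le_Suc_ex)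
    then show "(33 - t) * (292 + t) \<le> (145 - t) * (69 + t)"
      by (auto simp: algebra_simps)
  qed auto
qed

text \<open>With \<open>t = k - 283\<close>, this compares the representative at size
  \<open>k + 75\<close>, president absent, with nine tenths of the vice president's count at size
  \<open>k\<close>. Dividing by both coefficients of 536 weights the counts as the Shapley-Shubik
  index does, up to the factor 537.\<close>

lemma rep_le_vice_shifted:
  assumes "t \<le> 33"
  shows "10 * (434 choose 289) * (101 choose (68 + t)) * (536 choose (282 + t))
    \<le> 9 * (100 choose 50) * (435 choose (231 + t)) * (536 choose (357 + t))"
  using assms
proof (induction t)
  case 0
  \<comment> \<open>Everything is reduced to
    \<open>(434 choose 231) * (100 choose 50) * (536 choose 282)\<close>; the lengths 58, 17 and 75
    are the distances 289 - 231, 68 - 51 and 357 - 282.\<close>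
  show ?case
  proof (rule ratio_step[where p = "pochhammer 232 58 * pochhammer 52 17 * 51"
        and q = "10 * pochhammer 146 58 * pochhammer 34 17 * 101"
        and p' = "204 * pochhammer 283 75" and q' = "9 * 435 * pochhammer 180 75"])
    have "(101 choose 51) * 51 = (100 choose 50) * 101"
      "(101 choose 68) * pochhammer 52 17 = (101 choose 51) * pochhammer 34 17"
      "(434 choose 289) * pochhammer 232 58 = (434 choose 231) * pochhammer 146 58"
      using binomial_absorption[of 50 101] binomial_add_right[of 51 17 101] binomial_add_right[of 231 58 434]
      by (simp_all)
    then show "10 * (434 choose 289) * (101 choose (68 + 0)) * (536 choose (282 + 0))
          * (pochhammer 232 58 * pochhammer 52 17 * 51)
        = (434 choose 231) * (100 choose 50) * (536 choose 282)
          * (10 * pochhammer 146 58 * pochhammer 34 17 * 101)"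
      using mult_eq_mult_pair[OF _ mult_eq_mult_trans[of "101 choose 51" 51 "100 choose 50" 101 "101 choose 68" "pochhammer 52 17" "pochhammer 34 17" 1],
          of "434 choose 289" "pochhammer 232 58" "434 choose 231" "pochhammer 146 58" "10 * (536 choose 282)"]
      by (simp add: mult_ac)
    have "204 * (435 choose 231) = 435 * (434 choose 231)"
      "(536 choose 357) * pochhammer 283 75 = (536 choose 282) * pochhammer 180 75"
      using binomial_absorb_comp[of 435 231] binomial_add_right[of 282 75 536] by (simp_all)
    then show "9 * (100 choose 50) * (435 choose (231 + 0)) * (536 choose (357 + 0)) * (204 * pochhammer 283 75)
        = (434 choose 231) * (100 choose 50) * (536 choose 282) * (9 * 435 * pochhammer 180 75)"
      using mult_eq_mult_pair[of "435 choose 231" 204 "434 choose 231" 435 "536 choose 357" "pochhammer 283 75" "536 choose 282" "pochhammer 180 75" "9 * (100 choose 50)"]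
      by (simp add: mult_ac)
  qed (simp_all add: pochhammer_numeral)
next
  case (Suc t)
  show ?case
  proof (rule ratio_step[where p = "(69 + t) * (283 + t)" and q = "(33 - t) * (254 - t)"
        and p' = "(232 + t) * (358 + t)" and q' = "(204 - t) * (179 - t)"])
    show "10 * (434 choose 289) * (101 choose (68 + t)) * (536 choose (282 + t))
    \<le> 9 * (100 choose 50) * (435 choose (231 + t)) * (536 choose (357 + t))"
      using Suc by simp
    have "(101 choose (68 + Suc t)) * (69 + t) = (101 choose (68 + t)) * (33 - t)"
      and "(536 choose (282 + Suc t)) * (283 + t) = (536 choose (282 + t)) * (254 - t)"
      using binomial_Suc_right[of 101 "68 + t"] binomial_Suc_right[of 536 "282 + t"]
      by (simp_all del: binomial_Suc_Suc)
    then show "10 * (434 choose 289) * (101 choose (68 + Suc t)) * (536 choose (282 + Suc t)) * ((69 + t) * (283 + t)) =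
      10 * (434 choose 289) * (101 choose (68 + t)) * (536 choose (282 + t)) * ((33 - t) * (254 - t))"
      by (rule mult_eq_mult_pair)
    have "(435 choose (231 + Suc t)) * (232 + t) = (435 choose (231 + t)) * (204 - t)"
      and "(536 choose (357 + Suc t)) * (358 + t) = (536 choose (357 + t)) * (179 - t)"
      using binomial_Suc_right[of 435 "231 + t"] binomial_Suc_right[of 536 "357 + t"]
      by (simp_all del: binomial_Suc_Suc)
    then show "9 * (100 choose 50) * (435 choose (231 + Suc t)) * (536 choose (357 + Suc t)) * ((232 + t) * (358 + t)) =
      9 * (100 choose 50) * (435 choose (231 + t)) * (536 choose (357 + t)) * ((204 - t) * (179 - t))"
      by (rule mult_eq_mult_pair)
    \<comment> \<open>With four linear factors on each side the condition does not reduce to a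
      linear one, so the 34 values are checked one by one.\<close>
    have "\<forall>t\<in>set [0..<34]. (33 - t) * (254 - t) * ((232 + t) * (358 + t)) \<le> (204 - t) * (179 - t) * ((69 + t) * (283 + t::nat))"
      by (simp add: upt_conv_Cons del: set_upt)
    then show "(33 - t) * (254 - t) * ((232 + t) * (358 + t)) \<le> (204 - t) * (179 - t) * ((69 + t) * (283 + t))"
      using Suc.prems by simp
  qed auto
qed

text \<open>The minimal size is treated apart because only coalitions without the vice president
  exist there. The quotient of the two sides is exactly 200/201.\<close>

lemma rep_less_senator_357:
  "(434 choose 289) * (100 choose 67) < (99 choose 66) * (435 choose 290 :: nat)"
proof -
  have "67 * (100 choose 67) = 100 * (99 choose 66)" "290 * (435 choose 290) = 435 * (434 choose 289)"
    using binomial_absorption[of 66 100] binomial_absorption[of 289 435] by simp_all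
  then have "201 * ((434 choose 289) * (100 choose 67)) \<le> 200 * ((99 choose 66) * (435 choose 290 :: nat))"
    by - (rule ratio_step[OF order_refl[of "(434 choose 289) * (99 choose 66)"], where p = 67 and q = "201 * 100" and p' = 290 and q' = "200 * 435"], auto)
  moreover have "(99 choose 66) * (435 choose 290) > (0::nat)"
    by simp
  ultimately show ?thesis
    by linarith
qed

text \<open>The shift from 282 to the minimal size 357, obtained from
  \<open>rep_le_vice_shifted\<close> at \<open>t = 0\<close> by one ratio step downwards.\<close>

lemma rep_le_vice_357:
  "10 * (434 choose 289) * (100 choose 67) * (536 choose 281)
    \<le> 9 * (100 choose 50) * (435 choose 230) * (536 choose 356 :: nat)"
proof (rule ratio_step[OF rep_le_vice_shifted[of 0], where p = "101 * 255" and q = "68 * 282"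
      and p' = "205 * 180" and q' = "231 * 357"])
  have "68 * (101 choose 68) = 101 * (100 choose 67)" "(536 choose 282) * 282 = (536 choose 281) * 255"
    using binomial_absorption[of 67 101] binomial_Suc_right[of 536 281] by simp_all
  then show "10 * (434 choose 289) * (100 choose 67) * (536 choose 281) * (101 * 255)
    = 10 * (434 choose 289) * (101 choose (68 + 0)) * (536 choose (282 + 0)) * (68 * 282)"
    by (intro mult_eq_mult_pair) auto
  have "(435 choose 231) * 231 = (435 choose 230) * 205" "(536 choose 357) * 357 = (536 choose 356) * 180"
    using binomial_Suc_right[of 435 230] binomial_Suc_right[of 536 356] by simp_all
  then show "9 * (100 choose 50) * (435 choose 230) * (536 choose 356) * (205 * 180)
    = 9 * (100 choose 50) * (435 choose (231 + 0)) * (536 choose (357 + 0)) * (231 * 357)"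
    by (intro mult_eq_mult_pair) auto
qed auto

section \<open>Critical coalitions\<close>

text \<open>\<open>Z\<close> holds the players treated individually and \<open>E\<close> those of
  them who take part; \<open>X\<close> and \<open>Y\<close> are the rest of the two chambers, where
  only head counts matter.\<close>

definition slice :: "'a set \<Rightarrow> 'a set \<Rightarrow> 'a set \<Rightarrow> nat \<Rightarrow> 'a set \<Rightarrow> nat \<Rightarrow> 'a set set" where
  "slice Z E X a Y b =
     {T. T \<subseteq> Z \<union> X \<union> Y \<and> T \<inter> Z = E \<and> card (T \<inter> X) = a \<and> card (T \<inter> Y) = b}"

lemma card_slice:
  assumes "finite X" "finite Y" "Z \<inter> X = {}" "Z \<inter> Y = {}" "X \<inter> Y = {}" "E \<subseteq> Z"
  shows "card (slice Z E X a Y b) = (card X choose a) * (card Y choose b)"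
proof -
  let ?A = "{A. A \<subseteq> X \<and> card A = a}" and ?B = "{B. B \<subseteq> Y \<and> card B = b}"
  have "bij_betw (\<lambda>(A, B). E \<union> A \<union> B) (?A \<times> ?B) (slice Z E X a Y b)"
  proof (rule bij_betw_byWitness[where f' = "\<lambda>T. (T \<inter> X, T \<inter> Y)"])
    show "\<forall>p\<in>?A \<times> ?B. (\<lambda>T. (T \<inter> X, T \<inter> Y)) ((\<lambda>(A, B). E \<union> A \<union> B) p) = p"
      using assms by auto
    show "\<forall>T\<in>slice Z E X a Y b. (\<lambda>(A, B). E \<union> A \<union> B) ((\<lambda>T. (T \<inter> X, T \<inter> Y)) T) = T"
      using assms unfolding slice_def by auto
    show "(\<lambda>(A, B). E \<union> A \<union> B) ` (?A \<times> ?B) \<subseteq> slice Z E X a Y b"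
    proof clarify
      fix A B assume *: "A \<subseteq> X" "a = card A" "B \<subseteq> Y" "b = card B"
      then have "(E \<union> A \<union> B) \<inter> X = A" "(E \<union> A \<union> B) \<inter> Y = B" "(E \<union> A \<union> B) \<inter> Z = E"
        using assms by auto
      then show "E \<union> A \<union> B \<in> slice Z E X (card A) Y (card B)"
        using * assms(6) unfolding slice_def by auto
    qed
    show "(\<lambda>T. (T \<inter> X, T \<inter> Y)) ` slice Z E X a Y b \<subseteq> ?A \<times> ?B"
      unfolding slice_def by auto
  qed
  then have "card (slice Z E X a Y b) = card (?A \<times> ?B)"
    by (simp add: bij_betw_same_card)
  then show ?thesis
    by (simp add: card_cartesian_product n_subsets assms)
qed

section \<open>Winning and critical coalitions in terms of head counts\<close>

lemma finite_chambers [simp]: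
  "finite senators" "finite full_senate" "finite representatives" "finite players"
  by (auto simp: senators_def full_senate_def representatives_def players_def)

lemma chambers_disjoint [simp]:
  "senators \<inter> representatives = {}" "full_senate \<inter> representatives = {}"
  "VicePresident \<notin> senators" "VicePresident \<notin> representatives"
  "President \<notin> senators" "President \<notin> full_senate" "President \<notin> representatives"
  by (auto simp: senators_def full_senate_def representatives_def)

lemma chamber_memberships [simp]:
  "x \<in> senators \<Longrightarrow> x \<in> full_senate"
  "x \<in> senators \<Longrightarrow> x \<notin> representatives"
  "x \<in> full_senate \<Longrightarrow> x \<notin> representatives"
  by (auto simp: senators_def full_senate_def representatives_def)

lemma players_eq: "players = insert President (full_senate \<union> representatives)"
  by (auto simp: players_def full_senate_def)

lemma card_chambers [simp]:
  "card senators = 100" "card full_senate = 101" "card representatives = 435"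
  by (auto simp: full_senate_def) (auto simp: senators_def representatives_def card_image inj_on_def)

lemma card_coalition:
  assumes "T \<subseteq> players"
  shows "card T = (if President \<in> T then 1 else 0) + card (T \<inter> full_senate) + card (T \<inter> representatives)"
proof -
  have fin: "finite T"
    using assms finite_chambers(4) by (rule finite_subset)
  have "T = (T \<inter> {President}) \<union> ((T \<inter> full_senate) \<union> (T \<inter> representatives))"
    using assms by (auto simp: players_eq)
  also have "card \<dots> = card (T \<inter> {President}) + (card (T \<inter> full_senate) + card (T \<inter> representatives))"
    using fin chambers_disjoint by (subst card_Un_disjoint card_Un_disjoint, auto)+
  finally show ?thesis
    by auto
qed

lemma card_full_senate_part:
  assumes "T \<subseteq> players"
  shows "card (T \<inter> full_senate) = (if VicePresident \<in> T then 1 else 0) + card (T \<inter> senators)"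
  using finite_subset[OF assms finite_chambers(4)] by (auto simp: full_senate_def)

text \<open>Head counts suffice because a set with at least the required number of elements has a
  subset with exactly that number.\<close>

lemma winning_iff:
  assumes "T \<subseteq> players"
  shows "winning T \<longleftrightarrow>
      President \<in> T \<and> 51 \<le> card (T \<inter> full_senate) \<and> 218 \<le> card (T \<inter> representatives)
    \<or> 67 \<le> card (T \<inter> senators) \<and> 290 \<le> card (T \<inter> representatives)" (is "_ \<longleftrightarrow> ?I \<or> ?II")
proof -
  have fin: "finite (T \<inter> A)" for A
    using assms finite_subset[of T] by auto
  have "(\<exists>U\<subseteq>T. type_I U) \<longleftrightarrow> ?I"
  proof
    assume "\<exists>U\<subseteq>T. type_I U"
    then obtain A B where "A \<subseteq> T \<inter> full_senate" "card A = 51" "B \<subseteq> T \<inter> representatives" "card B = 218"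
      "President \<in> T"
      unfolding type_I_def by auto
    then show ?I
      using card_mono[OF fin] by metis
  next
    assume *: ?I
    then obtain A B where "A \<subseteq> T \<inter> full_senate" "card A = 51" "B \<subseteq> T \<inter> representatives" "card B = 218"
      by (meson obtain_subset_with_card_n)
    then show "\<exists>U\<subseteq>T. type_I U"
      using * unfolding type_I_def by (intro exI[of _ "{President} \<union> A \<union> B"]) auto
  qed
  moreover have "(\<exists>U\<subseteq>T. type_II U) \<longleftrightarrow> ?II"
  proof
    assume "\<exists>U\<subseteq>T. type_II U"
    then obtain A B where "A \<subseteq> T \<inter> senators" "card A = 67" "B \<subseteq> T \<inter> representatives" "card B = 290"
      unfolding type_II_def by auto
    then show ?II
      using card_mono[OF fin] by metis
  next
    assume ?II
    then obtain A B where "A \<subseteq> T \<inter> senators" "card A = 67" "B \<subseteq> T \<inter> representatives" "card B = 290"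
      by (meson obtain_subset_with_card_n)
    then show "\<exists>U\<subseteq>T. type_II U"
      unfolding type_II_def by (intro exI[of _ "A \<union> B"]) auto
  qed
  ultimately show ?thesis
    using assms unfolding winning_def by blast
qed

text \<open>With the president present, 67 senators and 290 representatives already meet the
  requirements of type I, so only type I decides for a senator or representative; without him only
  type II is possible. The vice president counts only in type I, and with 50 senators type II is out
  of reach.\<close>

lemma critical_iff:
  assumes "T \<subseteq> players"
  shows "critical winning T President \<longleftrightarrow>
      President \<in> T \<and> 51 \<le> card (T \<inter> full_senate) \<and> 218 \<le> card (T \<inter> representatives)
        \<and> \<not> (67 \<le> card (T \<inter> senators) \<and> 290 \<le> card (T \<inter> representatives))" (is ?P)
    and "critical winning T VicePresident \<longleftrightarrow>
      President \<in> T \<and> VicePresident \<in> T \<and> card (T \<inter> senators) = 50 \<and> 218 \<le> card (T \<inter> representatives)" (is ?V)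
    and "S \<in> senators \<Longrightarrow> critical winning T S \<longleftrightarrow> S \<in> T \<and>
      (if President \<in> T then card (T \<inter> full_senate) = 51 \<and> 218 \<le> card (T \<inter> representatives)
       else card (T \<inter> senators) = 67 \<and> 290 \<le> card (T \<inter> representatives))" (is "_ \<Longrightarrow> ?S")
    and "R \<in> representatives \<Longrightarrow> critical winning T R \<longleftrightarrow> R \<in> T \<and>
      (if President \<in> T then 51 \<le> card (T \<inter> full_senate) \<and> card (T \<inter> representatives) = 218
       else 67 \<le> card (T \<inter> senators) \<and> card (T \<inter> representatives) = 290)" (is "_ \<Longrightarrow> ?R")
proof -
  have fin: "finite T"
    using assms finite_chambers(4) by (rule finite_subset)
  have sub: "T - {i} \<subseteq> players" for i
    using assms by auto
  note iff = critical_def winning_iff[OF assms] winning_iff[OF sub] Int_Diff[symmetric]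
  have diff: "(T - {i}) \<inter> A = (if i \<in> A then T \<inter> A - {i} else T \<inter> A)" for i A
    by auto
  show ?P
    unfolding iff diff by auto
  show ?V
    unfolding iff diff using card_full_senate_part[OF assms] by (auto simp: full_senate_def)
  show ?S if "S \<in> senators"
  proof -
    have "S \<in> full_senate" "S \<notin> representatives" "S \<noteq> President"
      using that chambers_disjoint by (auto simp: full_senate_def)
    then show ?thesis
      using that card_full_senate_part[OF assms] unfolding iff diff by (auto simp: card_Diff_singleton split: if_splits)
  qed
  show ?R if "R \<in> representatives"
  proof -
    have "R \<notin> full_senate" "R \<notin> senators" "R \<noteq> President"
      using that chambers_disjoint by (auto simp: full_senate_def)
    then show ?thesis
      using that card_full_senate_part[OF assms] unfolding iff diff by (auto simp: card_Diff_singleton split: if_splits)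
  qed
qed

section \<open>Counting critical coalitions\<close>

text \<open>The counts below are split by the presence of the president (suffix \<open>I\<close>) or his absence
  (suffix \<open>II\<close>). Coalitions of the latter kind with and without the vice president are merged by
  Pascal's rule; in the smallest size 357 only those without him exist.\<close>

definition vice_count :: "nat \<Rightarrow> nat" where
  "vice_count k = (if 270 \<le> k then (100 choose 50) * (435 choose (k - 52)) else 0)"

text \<open>The guard \<open>270 = 1 + 51 + 218\<close> is the size of a minimal coalition of type
  I; at size 269 the product would count sets with only 50 members of the full Senate.\<close>

definition rep_count_I :: "nat \<Rightarrow> nat" where
  "rep_count_I k = (if 270 \<le> k then (434 choose 217) * (101 choose (k - 219)) else 0)"

text \<open>At size \<open>357 = 67 + 290\<close> the coefficient \<open>101 choose 67\<close> would
  also count sets with the vice president and 66 senators, which lose.\<close>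

definition rep_count_II :: "nat \<Rightarrow> nat" where
  "rep_count_II k =
     (if 357 < k then (434 choose 289) * (101 choose (k - 290))
      else if k = 357 then (434 choose 289) * (100 choose 67) else 0)"

definition senator_count_II :: "nat \<Rightarrow> nat" where
  "senator_count_II k =
     (if 357 < k then (99 choose 66) * (436 choose (k - 67))
      else if k = 357 then (99 choose 66) * (435 choose 290) else 0)"

lemma slice_mem_iff: "T \<in> slice Z E X a Y b \<Longrightarrow> i \<in> Z \<Longrightarrow> i \<in> T \<longleftrightarrow> i \<in> E"
  unfolding slice_def by blast

lemma finite_slice: "finite Z \<Longrightarrow> finite X \<Longrightarrow> finite Y \<Longrightarrow> finite (slice Z E X a Y b)"
  unfolding slice_def by simp

lemma finite_coalitions [simp]: "finite {T. T \<subseteq> players \<and> P T}"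
  by (rule finite_subset[of _ "Pow players"]) auto

lemma card_Int_remove:
  assumes "T \<subseteq> players" "i \<in> T" "i \<in> A"
  shows "card (T \<inter> A) = Suc (card (T \<inter> (A - {i})))"
  using card.remove[of "T \<inter> A" i] assms finite_subset[OF assms(1) finite_chambers(4)] by (simp add: Int_Diff)

text \<open>An exact value is required, since this count is the smaller side against a senator and
  the larger side against a representative.\<close>

lemma crit_count_vice_president: "crit_count players winning VicePresident k = vice_count k"
proof -
  let ?C = "{T. T \<subseteq> players \<and> card T = k \<and> critical winning T VicePresident}"
  let ?Z = "{President, VicePresident}"
  show ?thesis
  proof (cases "270 \<le> k")
    case True
    have "?C = slice ?Z ?Z senators 50 representatives (k - 52)"
    proof (intro set_eqI iffI)
      fix T assume "T \<in> ?C"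
      then have T: "T \<subseteq> players" "card T = k" "critical winning T VicePresident"
        by auto
      have crit: "President \<in> T" "VicePresident \<in> T" "card (T \<inter> senators) = 50"
        using T(3) critical_iff(2)[OF T(1)] by auto
      have "card (T \<inter> representatives) = k - 52"
        using card_coalition[OF T(1)] card_full_senate_part[OF T(1)] T(2) crit by simp
      then show "T \<in> slice ?Z ?Z senators 50 representatives (k - 52)"
        using T(1) crit by (auto simp: slice_def players_def)
    next
      fix T assume *: "T \<in> slice ?Z ?Z senators 50 representatives (k - 52)"
      then have T: "T \<subseteq> players" "President \<in> T" "VicePresident \<in> T"
        and c: "card (T \<inter> senators) = 50" "card (T \<inter> representatives) = k - 52"
        by (auto simp: slice_def players_def)
      have "card T = k"
        using card_coalition[OF T(1)] card_full_senate_part[OF T(1)] True T c by simp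
      then show "T \<in> ?C"
        using critical_iff(2)[OF T(1)] T c True by simp
    qed
    then show ?thesis
      using True by (simp add: crit_count_def vice_count_def card_slice)
  next
    case False
    then have "?C = {}"
      using card_coalition card_full_senate_part critical_iff(2) by fastforce
    then show ?thesis
      using False unfolding crit_count_def vice_count_def by simp
  qed
qed

text \<open>In coalitions with the president, a senator and the vice president have the same role:
  the other 100 members of the full Senate contribute exactly 50.\<close>

lemma crit_count_senator_ge_vice:
  assumes "S \<in> senators"
  shows "vice_count k \<le> crit_count players winning S k"
proof (cases "270 \<le> k")
  case True
  let ?Z = "{President, S}" and ?X = "full_senate - {S}"
  have S: "S \<in> full_senate" "S \<notin> representatives" "S \<noteq> President"
    using assms by auto
  have "slice ?Z ?Z ?X 50 representatives (k - 52)
      \<subseteq> {T. T \<subseteq> players \<and> card T = k \<and> critical winning T S}"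
  proof
    fix T assume *: "T \<in> slice ?Z ?Z ?X 50 representatives (k - 52)"
    then have T: "T \<subseteq> players" "President \<in> T" "S \<in> T"
      and c: "card (T \<inter> ?X) = 50" "card (T \<inter> representatives) = k - 52"
      using S by (auto simp: slice_def players_eq)
    have F: "card (T \<inter> full_senate) = 51"
      using card_Int_remove[OF T(1,3) S(1)] c(1) by linarith
    then have "card T = k"
      using card_coalition[OF T(1)] T(2) c(2) True by simp
    then show "T \<in> {T. T \<subseteq> players \<and> card T = k \<and> critical winning T S}"
      using critical_iff(3)[OF T(1) assms] T F c(2) True by simp
  qed
  from card_mono[OF _ this] show ?thesis
    using S by (simp add: crit_count_def vice_count_def card_slice Diff_Int_distrib2)
qed (simp add: vice_count_def)

text \<open>Only coalitions without the president are counted; this lower bound suffices at the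
  sizes where \<open>rep_count_I\<close> is zero.\<close>

lemma crit_count_senator_ge_II:
  assumes "S \<in> senators"
  shows "senator_count_II k \<le> crit_count players winning S k"
proof (cases "357 \<le> k")
  case True
  let ?Z = "{President, VicePresident, S}" and ?X = "senators - {S}"
  let ?A = "slice ?Z {S} ?X 66 representatives (k - 67)"
  let ?B = "slice ?Z {VicePresident, S} ?X 66 representatives (k - 68)"
  let ?C = "{T. T \<subseteq> players \<and> card T = k \<and> critical winning T S}"
  have S: "S \<in> full_senate" "S \<notin> representatives" "S \<noteq> President" "S \<noteq> VicePresident"
    using assms by auto
  have A: "?A \<subseteq> ?C"
  proof
    fix T assume *: "T \<in> ?A"
    then have sub: "T \<subseteq> ?Z \<union> ?X \<union> representatives"
      and c: "card (T \<inter> ?X) = 66" "card (T \<inter> representatives) = k - 67"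
      unfolding slice_def by blast+
    have "?Z \<union> ?X \<union> representatives \<subseteq> players"
      using assms by (auto simp: players_def)
    with sub have "T \<subseteq> players"
      by (rule order_trans)
    moreover have "President \<notin> T" "VicePresident \<notin> T" "S \<in> T"
      using slice_mem_iff[OF *, of President] slice_mem_iff[OF *, of VicePresident] slice_mem_iff[OF *, of S] S(3,4)
      by simp_all
    ultimately have T: "T \<subseteq> players" "President \<notin> T" "VicePresident \<notin> T" "S \<in> T" .
    have F: "card (T \<inter> senators) = 67"
      using card_Int_remove[OF T(1,4) assms] c(1) by linarith
    then have "card T = k"
      using card_coalition[OF T(1)] card_full_senate_part[OF T(1)] T c(2) True by simp
    then show "T \<in> ?C"
      using critical_iff(3)[OF T(1) assms] T F c(2) True by simp
  qed
  have B: "?B \<subseteq> ?C" if "357 < k"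
  proof
    fix T assume *: "T \<in> ?B"
    then have sub: "T \<subseteq> ?Z \<union> ?X \<union> representatives"
      and c: "card (T \<inter> ?X) = 66" "card (T \<inter> representatives) = k - 68"
      unfolding slice_def by blast+
    have "?Z \<union> ?X \<union> representatives \<subseteq> players"
      using assms by (auto simp: players_def)
    with sub have "T \<subseteq> players"
      by (rule order_trans)
    moreover have "President \<notin> T" "VicePresident \<in> T" "S \<in> T"
      using slice_mem_iff[OF *, of President] slice_mem_iff[OF *, of VicePresident] slice_mem_iff[OF *, of S] S(3,4)
      by simp_all
    ultimately have T: "T \<subseteq> players" "President \<notin> T" "VicePresident \<in> T" "S \<in> T" .
    have F: "card (T \<inter> senators) = 67"
      using card_Int_remove[OF T(1,4) assms] c(1) by linarith
    then have "card T = k"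
      using card_coalition[OF T(1)] card_full_senate_part[OF T(1)] T c(2) that by simp
    then show "T \<in> ?C"
      using critical_iff(3)[OF T(1) assms] T F c(2) that by simp
  qed
  have X: "card ?X = 99" "finite ?X" "?Z \<inter> ?X = {}" "?Z \<inter> representatives = {}" "?X \<inter> representatives = {}"
    using assms S by auto
  have cA: "card ?A = (99 choose 66) * (435 choose (k - 67))"
    and cB: "card ?B = (99 choose 66) * (435 choose (k - 68))"
    using X by (simp_all add: card_slice)
  show ?thesis
  proof (cases "357 < k")
    case True
    have "?A \<inter> ?B = {}"
      using S(4) by (auto simp: slice_def)
    moreover have "finite ?A" "finite ?B"
      by (simp_all add: finite_slice)
    ultimately have "card ?A + card ?B = card (?A \<union> ?B)"
      by (simp add: card_Un_disjoint)
    also have "\<dots> \<le> card ?C"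
      using A B[OF True] by (intro card_mono finite_coalitions Un_least)
    moreover have "k - 67 = Suc (k - 68)"
      using True by simp
    then have "436 choose (k - 67) = (435 choose (k - 67)) + (435 choose (k - 68))"
      using binomial_Suc_Suc[of 435 "k - 68"] by simp
    ultimately show ?thesis
      using True unfolding cA cB crit_count_def senator_count_II_def by (simp add: distrib_left)
  next
    case False
    then have "k = 357"
      using \<open>357 \<le> k\<close> by simp
    with card_mono[OF _ A] cA show ?thesis
      by (simp add: crit_count_def senator_count_II_def)
  qed
qed (simp add: senator_count_II_def)

text \<open>The slices are: president present, both absent, only the vice president present.
  Representatives occur only on the smaller side of inequalities, so inclusion in these slices is
  enough.\<close>

lemma crit_count_representative_le:
  assumes "R \<in> representatives"
  shows "crit_count players winning R k \<le> rep_count_I k + rep_count_II k"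
proof -
  let ?Z = "{President, VicePresident, R}" and ?Y = "representatives - {R}"
  let ?I = "slice {President, R} {President, R} full_senate (k - 219) ?Y 217"
  let ?A = "slice ?Z {R} senators (k - 290) ?Y 289"
  let ?B = "slice ?Z {VicePresident, R} senators (k - 291) ?Y 289"
  let ?C = "{T. T \<subseteq> players \<and> card T = k \<and> critical winning T R}"
  have R: "R \<notin> full_senate" "R \<notin> senators" "R \<noteq> President" "R \<noteq> VicePresident"
    using assms by auto
  have sub: "?C \<subseteq> (if 270 \<le> k then ?I else {}) \<union> (if 357 \<le> k then ?A else {}) \<union> (if 357 < k then ?B else {})"
  proof
    fix T assume T: "T \<in> ?C"
    then have crit: "T \<subseteq> players" "R \<in> T" and
      *: "if President \<in> T then 51 \<le> card (T \<inter> full_senate) \<and> card (T \<inter> representatives) = 218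
       else 67 \<le> card (T \<inter> senators) \<and> card (T \<inter> representatives) = 290"
      using critical_iff(4)[of T R] assms by auto
    have T_eq: "card T = k" and E: "T \<subseteq> {President, VicePresident, R} \<union> senators \<union> ?Y"
      using T crit by (auto simp: players_def)
    have size: "k = (if President \<in> T then 1 else 0) + card (T \<inter> full_senate) + card (T \<inter> representatives)"
      using card_coalition[OF crit(1)] T_eq by simp
    note reps = card_Int_remove[OF crit assms]
    show "T \<in> (if 270 \<le> k then ?I else {}) \<union> (if 357 \<le> k then ?A else {}) \<union> (if 357 < k then ?B else {})"
    proof (cases "President \<in> T")
      case True
      then have "270 \<le> k" "card (T \<inter> full_senate) = k - 219" "card (T \<inter> ?Y) = 217"
        using size * reps by simp_all
      moreover have "T \<inter> {President, R} = {President, R}" "T \<subseteq> {President, R} \<union> full_senate \<union> ?Y"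
        using True crit by (auto simp: players_eq)
      ultimately show ?thesis
        unfolding slice_def by auto
    next
      case P: False
      then have Y: "card (T \<inter> ?Y) = 289"
        using * reps by simp
      show ?thesis
      proof (cases "VicePresident \<in> T")
        case True
        then have "357 < k" "card (T \<inter> senators) = k - 291"
          using P * size card_full_senate_part[OF crit(1)] by simp_all
        moreover have "T \<inter> ?Z = {VicePresident, R}"
          using P True crit by auto
        ultimately show ?thesis
          using Y E unfolding slice_def by auto
      next
        case False
        then have "357 \<le> k" "card (T \<inter> senators) = k - 290"
          using P * size card_full_senate_part[OF crit(1)] by simp_all
        moreover have "T \<inter> ?Z = {R}"
          using P False crit by auto
        ultimately show ?thesis
          using Y E unfolding slice_def by auto
      qed
    qed
  qed
  have Y: "card ?Y = 434" "finite ?Y" "?Z \<inter> ?Y = {}" "{President, R} \<inter> ?Y = {}"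
    "?Z \<inter> senators = {}" "{President, R} \<inter> full_senate = {}" "senators \<inter> ?Y = {}" "full_senate \<inter> ?Y = {}"
    using assms R by auto
  have cards: "card ?I = (101 choose (k - 219)) * (434 choose 217)"
    "card ?A = (100 choose (k - 290)) * (434 choose 289)"
    "card ?B = (100 choose (k - 291)) * (434 choose 289)"
    using Y by (simp_all add: card_slice)
  have card_if: "card (if b then A else {}) = (if b then card A else 0)" for b and A :: "player set set"
    by simp
  have "card ?C \<le> card ((if 270 \<le> k then ?I else {}) \<union> (if 357 \<le> k then ?A else {}) \<union> (if 357 < k then ?B else {}))"
    by (rule card_mono[OF _ sub]) (simp add: finite_slice)
  also have "\<dots> \<le> card (if 270 \<le> k then ?I else {}) + card (if 357 \<le> k then ?A else {}) + card (if 357 < k then ?B else {})"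
    by (meson add_mono card_Un_le le_refl order_trans)
  also have "\<dots> = (if 270 \<le> k then (101 choose (k - 219)) * (434 choose 217) else 0)
      + (if 357 \<le> k then (100 choose (k - 290)) * (434 choose 289) else 0)
      + (if 357 < k then (100 choose (k - 291)) * (434 choose 289) else 0)"
    unfolding card_if cards ..
  also have "\<dots> = rep_count_I k + rep_count_II k"
  proof (cases "357 < k")
    case True
    then have "k - 290 = Suc (k - 291)"
      by simp
    then have "101 choose (k - 290) = (100 choose (k - 290)) + (100 choose (k - 291))"
      using binomial_Suc_Suc[of 100 "k - 291"] by simp
    then show ?thesis
      using True by (simp add: rep_count_I_def rep_count_II_def algebra_simps)
  qed (auto simp: rep_count_I_def rep_count_II_def)
  finally show ?thesis
    unfolding crit_count_def .
qed

lemma crit_count_president_greater: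
  assumes "S \<in> senators"
  shows "crit_count players winning S k < crit_count players winning President k
    \<or> crit_count players winning President k = 0 \<and> crit_count players winning S k = 0"
proof -
  let ?C = "{T. T \<subseteq> players \<and> card T = k \<and> critical winning T S}"
  let ?P = "{T. T \<subseteq> players \<and> card T = k \<and> critical winning T President}"
  txt \<open>Exchanging the senator for the president turns a coalition critical for the senator into one
    critical for the president: with 66 senators and 290 representatives the president's bill passes.\<close>
  define f where "f T = (if President \<in> T then T else insert President (T - {S}))" for T
  have S: "S \<in> full_senate" "S \<notin> representatives" "S \<noteq> President"
    using assms by auto
  \<comment> \<open>Every coalition in \<open>?C\<close> contains \<open>S\<close>, so the absence
    of \<open>S\<close> from the image reveals that an exchange took place.\<close>
  have inj: "inj_on f ?C"
  proof (rule inj_on_inverseI[where g = "\<lambda>T. if S \<in> T then T else insert S (T - {President})"])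
    fix T assume "T \<in> ?C"
    then have "S \<in> T"
      by (simp add: critical_def)
    then show "(if S \<in> f T then f T else insert S (f T - {President})) = T"
      using S(3) by (auto simp: f_def)
  qed
  \<comment> \<open>\<open>out\<close> is a necessary condition for lying in the image of
    \<open>f\<close>; the witness \<open>E\<close> is chosen to violate it.\<close>
  have out: "S \<in> T \<and> card (T \<inter> full_senate) = 51 \<or> S \<notin> T \<and> card (T \<inter> senators) = 66"
    and sub: "T \<in> ?P" if T: "T \<in> f ` ?C" for T
  proof -
    from T obtain U where U: "U \<subseteq> players" "card U = k" "critical winning U S" and T_eq: "T = f U"
      by blast
    note crit = critical_iff(3)[OF U(1) assms]
    have SU: "S \<in> U"
      using U(3) by (simp add: critical_def)
    have "(S \<in> T \<and> card (T \<inter> full_senate) = 51 \<or> S \<notin> T \<and> card (T \<inter> senators) = 66) \<and> T \<in> ?P"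
    proof (cases "President \<in> U")
      case True
      then have "T = U" and c: "card (U \<inter> full_senate) = 51" "218 \<le> card (U \<inter> representatives)"
        using U(3) T_eq crit by (simp_all add: f_def)
      moreover have "card (U \<inter> senators) \<le> 51"
        using card_full_senate_part[OF U(1)] c(1) by simp
      ultimately show ?thesis
        using True SU U(1,2) critical_iff(1)[OF U(1)] by simp
    next
      case False
      then have c: "card (U \<inter> senators) = 67" "290 \<le> card (U \<inter> representatives)"
        using U(3) crit by simp_all
      have T: "T = insert President (U - {S})"
        using False T_eq by (simp add: f_def)
      have fin: "finite U"
        using U(1) finite_chambers(4) by (rule finite_subset)
      have "card T = Suc (card (U - {S}))"
        using False fin by (simp add: T)
      then have cT: "card T = k" "T \<subseteq> players"
        using card.remove[OF fin SU] U(1,2) by (auto simp: T players_eq)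
      have eq: "T \<inter> senators = U \<inter> (senators - {S})" "T \<inter> full_senate = U \<inter> (full_senate - {S})"
        "T \<inter> representatives = U \<inter> representatives"
        using S by (auto simp: T)
      have sen: "card (T \<inter> senators) = 66"
        using card_Int_remove[OF U(1) SU assms] c(1) unfolding eq by linarith
      then have "51 \<le> card (T \<inter> full_senate)"
        using card_full_senate_part[OF cT(2)] by simp
      moreover have "S \<notin> T" "President \<in> T"
        using S by (auto simp: T)
      ultimately show ?thesis
        using sen c(2) cT critical_iff(1)[OF cT(2)] eq(3) by simp
    qed
    then show "S \<in> T \<and> card (T \<inter> full_senate) = 51 \<or> S \<notin> T \<and> card (T \<inter> senators) = 66" "T \<in> ?P"
      by blast+
  qed
  txt \<open>The coalition \<open>E\<close> constructed below witnesses that the injection is not onto.\<close>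
  show ?thesis
  proof (cases "?P = {}")
    case True
    then have "?C = {}"
      using sub by blast
    with True show ?thesis
      unfolding crit_count_def by (metis card.empty)
  next
    case False
    then obtain T where T: "T \<subseteq> players" "card T = k" "critical winning T President"
      by blast
    have lt: "card (T \<inter> full_senate) \<le> 101" "card (T \<inter> representatives) \<le> 435"
      using card_mono[of full_senate "T \<inter> full_senate"] card_mono[of representatives "T \<inter> representatives"] by auto
    \<comment> \<open>The upper bound is \<open>1 + 67 + 435\<close>: with 290 or more
      representatives, at most 66 senators and the vice president may be present.\<close>
    have k: "270 \<le> k" "k \<le> 503"
      using T(2,3) critical_iff(1)[OF T(1)] card_coalition[OF T(1)] card_full_senate_part[OF T(1)] lt
      by (auto split: if_splits)
    \<comment> \<open>\<open>A\<close> is the full Senate part of the witness. Without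
      \<open>S\<close>, 51 members include too few senators for \<open>out\<close> and serve up to
      size \<open>487 = 51 + 436\<close>. Beyond that, 67 members with \<open>S\<close> and the vice
      president exceed 51, yet their 66 senators keep type II from winning.\<close>
    obtain A where A: "A \<subseteq> full_senate" "card A + 219 \<le> k" "k \<le> card A + 436"
      "card A = 51 \<and> S \<notin> A \<or> card A = 67 \<and> S \<in> A \<and> VicePresident \<in> A"
    proof (cases "k \<le> 487")
      case True
      have "51 \<le> card (full_senate - {S})"
        using S by simp
      then obtain A where A: "A \<subseteq> full_senate - {S}" "card A = 51"
        by (meson obtain_subset_with_card_n)
      show thesis
      proof (rule that[of A])
        show "A \<subseteq> full_senate" "card A = 51 \<and> S \<notin> A \<or> card A = 67 \<and> S \<in> A \<and> VicePresident \<in> A"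
          using A by blast+
        show "card A + 219 \<le> k" "k \<le> card A + 436"
          using A(2) k True by simp_all
      qed
    next
      case False
      have "65 \<le> card (senators - {S})"
        using assms by simp
      then obtain A where A: "A \<subseteq> senators - {S}" "card A = 65" "finite A"
        by (meson obtain_subset_with_card_n)
      have "S \<notin> A" "VicePresident \<notin> insert S A"
        using A(1) assms by auto
      then have "card (insert VicePresident (insert S A)) = 67"
        using A(2,3) by simp
      moreover have "insert VicePresident (insert S A) \<subseteq> full_senate"
        using A(1) assms by (auto simp: full_senate_def)
      ultimately show thesis
        by (intro that[of "insert VicePresident (insert S A)"]) (use k False in simp_all)
    qed
    have "k - Suc (card A) \<le> card representatives"
      using A(3) by simp
    then obtain B where B: "B \<subseteq> representatives" "card B = k - Suc (card A)"
      by (meson obtain_subset_with_card_n)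
    define E where "E = insert President (A \<union> B)"
    have E: "E \<subseteq> players" "President \<in> E" "E \<inter> full_senate = A" "E \<inter> representatives = B"
      using A(1) B(1) by (auto simp: E_def players_eq)
    have "VicePresident \<notin> B"
      using B(1) chambers_disjoint(4) by blast
    then have "VicePresident \<in> E \<longleftrightarrow> VicePresident \<in> A"
      by (simp add: E_def)
    then have sen: "card (E \<inter> senators) = card A - (if VicePresident \<in> A then 1 else 0)"
      using card_full_senate_part[OF E(1)] unfolding E(3) by simp
    have "S \<notin> B"
      using S B(1) by blast
    then have SE: "S \<in> E \<longleftrightarrow> S \<in> A"
      using S(3) by (simp add: E_def)
    have "card E = k"
      using card_coalition[OF E(1)] E A(2) B(2) by simp
    moreover have "51 \<le> card A" "218 \<le> card B" "card (E \<inter> senators) < 67"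
      using A(2,4) B(2) sen by auto
    ultimately have "E \<in> ?P"
      using E(1,2) critical_iff(1)[OF E(1)] unfolding E(3,4) by simp
    moreover have "E \<notin> f ` ?C"
      using out[of E] A(4) sen SE unfolding E(3) by auto
    ultimately have "f ` ?C \<subset> ?P"
      using sub by blast
    then have "card (f ` ?C) < card ?P"
      by (intro psubset_card_mono) auto
    then show ?thesis
      using inj unfolding crit_count_def by (simp add: card_image)
  qed
qed

section \<open>Dominations and power indices\<close>

text \<open>The support ends at \<open>320 = 219 + 101\<close>. The second bound yields strict
  domination; the last one reserves nine tenths of \<open>vice_count\<close> for the shift.\<close>

lemma rep_count_I_bounds:
  shows "rep_count_I k \<le> vice_count k"
    and "270 \<le> k \<Longrightarrow> k \<le> 320 \<Longrightarrow> rep_count_I k < vice_count k"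
    and "320 < k \<Longrightarrow> rep_count_I k = 0"
    and "282 \<le> k \<Longrightarrow> 10 * rep_count_I k \<le> vice_count k"
proof -
  show zero: "320 < k \<Longrightarrow> rep_count_I k = 0" for k
    by (simp add: rep_count_I_def)
  show less: "rep_count_I k < vice_count k" if k: "270 \<le> k" "k \<le> 320" for k
  proof -
    have "200 * rep_count_I k \<le> 199 * vice_count k"
      using rep_le_senator_I[of "k - 270"] k by (simp add: rep_count_I_def vice_count_def)
    moreover have "0 < vice_count k"
      using k by (simp add: vice_count_def)
    ultimately show ?thesis
      by linarith
  qed
  show "rep_count_I k \<le> vice_count k"
  proof (cases "270 \<le> k \<and> k \<le> 320")
    case False
    then have "rep_count_I k = 0"
      using zero[of k] by (cases "270 \<le> k") (simp_all add: rep_count_I_def)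
    then show ?thesis
      by simp
  qed (use less[of k] in simp)
  show "10 * rep_count_I k \<le> vice_count k" if k: "282 \<le> k"
  proof (cases "k \<le> 320")
    case True
    then show ?thesis
      using rep_le_vice[of "k - 282"] k by (simp add: rep_count_I_def vice_count_def)
  qed (use zero[of k] in simp)
qed

lemma rep_count_II_eq_0: "k < 357 \<or> 391 < k \<Longrightarrow> rep_count_II k = 0"
  by (auto simp: rep_count_II_def)

lemma rep_count_II_less_senator:
  assumes "357 \<le> k" "k \<le> 391"
  shows "rep_count_II k < senator_count_II k"
proof (cases "k = 357")
  case True
  then show ?thesis
    using rep_less_senator_357 by (simp add: rep_count_II_def senator_count_II_def)
next
  case False
  then have "200 * rep_count_II k \<le> 199 * senator_count_II k"
    using rep_le_senator_II[of "k - 358"] assms by (simp add: rep_count_II_def senator_count_II_def)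
  moreover have "k - 67 \<le> 436"
    using assms(2) by linarith
  then have "0 < senator_count_II k"
    using assms(1) by (simp add: senator_count_II_def)
  ultimately show ?thesis
    by linarith
qed

text \<open>The shift by 75 carries the range 282 to 316 exactly onto 357 to 391, the support of
  \<open>rep_count_II\<close>.\<close>

lemma rep_count_II_shifted:
  assumes "282 \<le> k" "k \<le> 316"
  shows "10 * rep_count_II (k + 75) * (536 choose (k - 1)) \<le> 9 * vice_count k * (536 choose (k + 74))"
proof (cases "k = 282")
  case True
  then show ?thesis
    using rep_le_vice_357 by (simp add: rep_count_II_def vice_count_def)
next
  case False
  then show ?thesis
    using rep_le_vice_shifted[of "k - 283"] assms
    by (simp add: rep_count_II_def vice_count_def mult.assoc add.commute)
qed

section \<open>From dominations to inequalities of indices\<close>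

lemma strictly_dominates_imp_weakly:
  "strictly_dominates N W i j \<Longrightarrow> weakly_dominates N W i j"
  unfolding strictly_dominates_def weakly_dominates_def by (metis le_refl less_imp_le)

lemma weakly_dominates_index_le:
  assumes "weakly_dominates N W i j" "\<forall>k\<in>{1..card N}. 0 \<le> lam k"
  shows "index_of N W lam j \<le> index_of N W lam i"
  using assms unfolding weakly_dominates_def index_of_def
  by (intro sum_mono mult_left_mono) auto

text \<open>A nonzero index provides a size with positive weight and nonzero count, where the
  domination is strict. If all weight lay on sizes with zero counts, both indices would
  vanish.\<close>

lemma strictly_dominates_index_less:
  assumes "strictly_dominates N W i j" "\<forall>k\<in>{1..card N}. 0 \<le> lam k" "index_of N W lam i \<noteq> 0"
  shows "index_of N W lam j < index_of N W lam i"
proof -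
  obtain k where k: "k \<in> {1..card N}" "lam k \<noteq> 0" "crit_count N W i k \<noteq> 0"
    using assms(3) sum.neutral[of "{1..card N}" "\<lambda>k. lam k * real (crit_count N W i k)"]
    unfolding index_of_def by fastforce
  have "0 < lam k"
    using assms(2) k by force
  have "(\<Sum>k=1..card N. lam k * real (crit_count N W j k)) < (\<Sum>k=1..card N. lam k * real (crit_count N W i k))"
  proof (rule sum_strict_mono_ex1)
    show "\<forall>k\<in>{1..card N}. lam k * real (crit_count N W j k) \<le> lam k * real (crit_count N W i k)"
      using strictly_dominates_imp_weakly[OF assms(1)] assms(2)
      by (auto simp: weakly_dominates_def intro!: mult_left_mono)
    show "\<exists>k\<in>{1..card N}. lam k * real (crit_count N W j k) < lam k * real (crit_count N W i k)"
      using assms(1) k \<open>0 < lam k\<close> by (auto simp: strictly_dominates_def intro!: bexI[of _ k])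
  qed simp
  then show ?thesis
    unfolding index_of_def .
qed

lemma president_strictly_dominates_senator:
  assumes "S \<in> senators"
  shows "strictly_dominates players winning President S"
  unfolding strictly_dominates_def using crit_count_president_greater[OF assms] by blast

lemma senator_weakly_dominates_vice_president:
  assumes "S \<in> senators"
  shows "weakly_dominates players winning S VicePresident"
  unfolding weakly_dominates_def crit_count_vice_president
  using crit_count_senator_ge_vice[OF assms] by blast

text \<open>The supports of \<open>rep_count_I\<close> and \<open>rep_count_II\<close> are the
  disjoint ranges 270 to 320 and 357 to 391, so at each size at most one part is active, and the
  matching part of the senator's count exceeds it.\<close>

lemma senator_strictly_dominates_representative:
  assumes "S \<in> senators" "R \<in> representatives"
  shows "strictly_dominates players winning S R"
  unfolding strictly_dominates_def
proof (intro ballI impI)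
  fix k
  let ?s = "crit_count players winning S k" and ?r = "crit_count players winning R k"
  assume "\<not> (?s = 0 \<and> ?r = 0)"
  moreover have r: "?r \<le> rep_count_I k + rep_count_II k"
    using assms(2) by (rule crit_count_representative_le)
  moreover have "rep_count_I k + rep_count_II k < ?s" if "rep_count_I k + rep_count_II k \<noteq> 0"
  proof (cases "k < 357")
    case True
    then have "rep_count_II k = 0" "270 \<le> k" "k \<le> 320"
      using that rep_count_I_bounds(3)[of k] rep_count_II_eq_0[of k] by (auto simp: rep_count_I_def split: if_splits intro: ccontr)
    then show ?thesis
      using rep_count_I_bounds(2)[of k] crit_count_senator_ge_vice[OF assms(1), of k] by linarith
  next
    case False
    then have "rep_count_I k = 0" "k \<le> 391"
      using that rep_count_I_bounds(3)[of k] rep_count_II_eq_0[of k] by (auto intro: ccontr)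
    then show ?thesis
      using False rep_count_II_less_senator[of k] crit_count_senator_ge_II[OF assms(1), of k] by linarith
  qed
  ultimately show "?r < ?s"
    by (cases "rep_count_I k + rep_count_II k = 0") linarith+
qed

text \<open>A representative has more critical coalitions than the vice president in sizes around 360. These
  are charged, shifted by 75, to the surplus of the vice president in sizes 282 to 316. The hypothesis
  \<open>shift\<close> says that \<open>\<lambda>\<^sub>k * (n - 1 choose k - 1)\<close> does not increase under the shift.\<close>

lemma vice_president_index_greater:
  assumes R: "R \<in> representatives"
    and nonneg: "\<forall>k\<in>{1..537}. 0 \<le> lam k"
    and pos: "0 < lam 270"
    and shift: "\<forall>k\<in>{282..316}. lam (k + 75) * real (536 choose (k + 74)) \<le> lam k * real (536 choose (k - 1))"
  shows "index_of players winning lam R < index_of players winning lam VicePresident"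
proof -
  let ?v = "\<lambda>k. real (vice_count k)" and ?I = "\<lambda>k. real (rep_count_I k)" and ?II = "\<lambda>k. real (rep_count_II k)"
  \<comment> \<open>The comparison of counts is multiplied by the weight, \<open>shift\<close> is
    applied, and the positive coefficient \<open>?b\<close> is cancelled.\<close>
  have shifted: "lam (k + 75) * ?II (k + 75) \<le> lam k * (9 / 10 * ?v k)" if k: "k \<in> {282..316}" for k
  proof -
    let ?b = "real (536 choose (k - 1))" and ?c = "real (536 choose (k + 74))"
    have "0 \<le> lam (k + 75)"
      using nonneg k by auto
    have "real (10 * rep_count_II (k + 75) * (536 choose (k - 1))) \<le> real (9 * vice_count k * (536 choose (k + 74)))"
      using rep_count_II_shifted[of k] k by (intro of_nat_mono) auto
    then have "?II (k + 75) * ?b \<le> 9 / 10 * ?v k * ?c"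
      by simp
    then have "lam (k + 75) * (?II (k + 75) * ?b) \<le> lam (k + 75) * (9 / 10 * ?v k * ?c)"
      using \<open>0 \<le> lam (k + 75)\<close> by (rule mult_left_mono)
    also have "\<dots> = 9 / 10 * ?v k * (lam (k + 75) * ?c)"
      by simp
    also have "\<dots> \<le> 9 / 10 * ?v k * (lam k * ?b)"
      using shift k by (intro mult_left_mono) auto
    finally have "lam (k + 75) * ?II (k + 75) * ?b \<le> lam k * (9 / 10 * ?v k) * ?b"
      by (simp add: mult_ac)
    moreover have "k - 1 \<le> 536"
      using k unfolding atLeastAtMost_iff by linarith
    then have "0 < ?b"
      by simp
    ultimately show ?thesis
      by (simp only: mult_le_cancel_right_pos)
  qed
  have "(\<Sum>k=1..537. lam k * ?II k) = (\<Sum>k=282+75..316+75. lam k * ?II k)"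
    by (rule sum.mono_neutral_right) (auto simp: rep_count_II_eq_0)
  also have "\<dots> = (\<Sum>k=282..316. lam (k + 75) * ?II (k + 75))"
    by (rule sum.shift_bounds_cl_nat_ivl)
  also have "\<dots> \<le> (\<Sum>k=282..316. lam k * (9 / 10 * ?v k))"
    using shifted by (rule sum_mono)
  also have "\<dots> = (\<Sum>k=1..537. if k \<in> {282..316} then lam k * (9 / 10 * ?v k) else 0)"
    by (subst sum.inter_restrict[symmetric]) (auto intro!: sum.cong)
  finally have II: "(\<Sum>k=1..537. lam k * ?II k)
      \<le> (\<Sum>k=1..537. if k \<in> {282..316} then lam k * (9 / 10 * ?v k) else 0)" .
  have "index_of players winning lam R \<le> (\<Sum>k=1..537. lam k * ?I k + lam k * ?II k)"
    unfolding index_of_def card_players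
  proof (rule sum_mono)
    fix k :: nat assume "k \<in> {1..537}"
    then show "lam k * real (crit_count players winning R k) \<le> lam k * ?I k + lam k * ?II k"
      using nonneg crit_count_representative_le[OF R, of k]
      by (simp flip: distrib_left of_nat_add add: mult_left_mono)
  qed
  also have "\<dots> = (\<Sum>k=1..537. lam k * ?I k) + (\<Sum>k=1..537. lam k * ?II k)"
    by (rule sum.distrib)
  also have "\<dots> \<le> (\<Sum>k=1..537. lam k * ?I k)
      + (\<Sum>k=1..537. if k \<in> {282..316} then lam k * (9 / 10 * ?v k) else 0)"
    using II by (rule add_left_mono)
  also have "\<dots> = (\<Sum>k=1..537. lam k * ?I k + (if k \<in> {282..316} then lam k * (9 / 10 * ?v k) else 0))"
    by (rule sum.distrib[symmetric])
  also have "\<dots> < (\<Sum>k=1..537. lam k * ?v k)"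
  proof (rule sum_strict_mono_ex1)
    show "\<forall>k\<in>{1..537}. lam k * ?I k + (if k \<in> {282..316} then lam k * (9 / 10 * ?v k) else 0) \<le> lam k * ?v k"
    proof
      fix k :: nat assume "k \<in> {1..537}"
      then have "0 \<le> lam k"
        using nonneg by blast
      \<comment> \<open>Budget at each size: one tenth of \<open>vice_count\<close> for the
        coalitions with the president, nine tenths for the shifted ones.\<close>
      have "?I k + (if k \<in> {282..316} then 9 / 10 * ?v k else 0) \<le> ?v k"
      proof (cases "k \<in> {282..316}")
        case True
        then have "real (10 * rep_count_I k) \<le> ?v k"
          using rep_count_I_bounds(4)[of k] by (intro of_nat_mono) simp
        then show ?thesis
          using True by simp
      qed (use rep_count_I_bounds(1)[of k] in auto)
      then have "lam k * (?I k + (if k \<in> {282..316} then 9 / 10 * ?v k else 0)) \<le> lam k * ?v k"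
        using \<open>0 \<le> lam k\<close> by (rule mult_left_mono)
      then show "lam k * ?I k + (if k \<in> {282..316} then lam k * (9 / 10 * ?v k) else 0) \<le> lam k * ?v k"
        by (auto simp: distrib_left split: if_splits)
    qed
    \<comment> \<open>Strictness comes from size 270, which lies below the charged range and has
      positive weight.\<close>
    show "\<exists>k\<in>{1..537}. lam k * ?I k + (if k \<in> {282..316} then lam k * (9 / 10 * ?v k) else 0) < lam k * ?v k"
      using pos rep_count_I_bounds(2)[of 270] by (intro bexI[of _ 270]) simp_all
  qed simp
  also have "\<dots> = index_of players winning lam VicePresident"
    unfolding index_of_def card_players crit_count_vice_president ..
  finally show ?thesis .
qed

text \<open>Size 500 exceeds \<open>487 = 52 + 435\<close>, the largest size at which the vice
  president can be critical, while a senator is still critical in some coalitions without the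
  president.\<close>

lemma senator_index_greater_vice_president:
  assumes S: "S \<in> senators"
    and nonneg: "\<forall>k\<in>{1..537}. 0 \<le> lam k"
    and pos: "0 < lam 500"
  shows "index_of players winning lam VicePresident < index_of players winning lam S"
  unfolding index_of_def card_players
proof (rule sum_strict_mono_ex1)
  show "\<forall>k\<in>{1..537}. lam k * real (crit_count players winning VicePresident k) \<le> lam k * real (crit_count players winning S k)"
    using nonneg crit_count_senator_ge_vice[OF S]
    by (auto simp: crit_count_vice_president intro!: mult_left_mono)
  have "vice_count 500 = 0" "0 < senator_count_II 500"
    by (simp_all add: vice_count_def senator_count_II_def)
  then have "crit_count players winning VicePresident 500 < crit_count players winning S 500"
    using crit_count_senator_ge_II[OF S, of 500] by (simp add: crit_count_vice_president)
  then show "\<exists>k\<in>{1..537}. lam k * real (crit_count players winning VicePresident k) < lam k * real (crit_count players winning S k)"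
    using pos by (intro bexI[of _ 500]) auto
qed simp

theorem theorem3:
  fixes S R :: player
  assumes "S \<in> senators" and "R \<in> representatives"
  shows "strictly_dominates players winning President S
    \<and> strictly_dominates players winning S R
    \<and> weakly_dominates players winning S VicePresident
    \<and> (\<forall>\<Phi>. power_index players winning \<Phi> \<and> \<Phi> President \<noteq> 0 \<and> \<Phi> S \<noteq> 0 \<longrightarrow>
          \<Phi> President > \<Phi> S \<and> \<Phi> S > \<Phi> R \<and> \<Phi> S \<ge> \<Phi> VicePresident)
    \<and> (\<forall>\<Phi>. \<Phi> = banzhaf players winning \<or> \<Phi> = shapley_shubik players winning \<longrightarrow>
          \<Phi> President > \<Phi> S \<and> \<Phi> S > \<Phi> VicePresident \<and> \<Phi> VicePresident > \<Phi> R)"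
proof (intro conjI allI impI)
  show PS: "strictly_dominates players winning President S"
    using assms(1) by (rule president_strictly_dominates_senator)
  show SR: "strictly_dominates players winning S R"
    using assms by (rule senator_strictly_dominates_representative)
  show SV: "weakly_dominates players winning S VicePresident"
    using assms(1) by (rule senator_weakly_dominates_vice_president)
  {
    fix \<Phi> assume "power_index players winning \<Phi> \<and> \<Phi> President \<noteq> 0 \<and> \<Phi> S \<noteq> 0"
    then obtain lam where lam: "\<forall>k\<in>{1..card players}. 0 \<le> lam k" "\<Phi> = index_of players winning lam"
      and nz: "\<Phi> President \<noteq> 0" "\<Phi> S \<noteq> 0"
      unfolding power_index_def weighting_def by blast
    show "\<Phi> S < \<Phi> President"
      using strictly_dominates_index_less[OF PS lam(1)] nz(1) unfolding lam(2) by blast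
    show "\<Phi> R < \<Phi> S"
      using strictly_dominates_index_less[OF SR lam(1)] nz(2) unfolding lam(2) by blast
    show "\<Phi> VicePresident \<le> \<Phi> S"
      using weakly_dominates_index_le[OF SV lam(1)] unfolding lam(2) .
  }
  fix \<Phi> assume \<Phi>: "\<Phi> = banzhaf players winning \<or> \<Phi> = shapley_shubik players winning"
  \<comment> \<open>Both indices have positive weights and satisfy the shift condition; the rest of
    the argument is common to them.\<close>
  obtain lam where lam: "\<Phi> = index_of players winning lam" "\<forall>k\<in>{1..537}. 0 < lam k"
    "\<forall>k\<in>{282..316}. lam (k + 75) * real (536 choose (k + 74)) \<le> lam k * real (536 choose (k - 1))"
  proof (cases "\<Phi> = banzhaf players winning")
    case True
    \<comment> \<open>Banzhaf weights are constant, so the condition concerns binomial coefficients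
      alone; these decrease since \<open>k - 1 \<ge> 281\<close> is past the middle 268.\<close>
    have "(536 choose (k + 74)) \<le> (536 choose (k - 1) :: nat)" if "k \<in> {282..316}" for k
      using that by (intro binomial_antimono) auto
    then show thesis
      using True by (intro that[of "\<lambda>k. 1 / 2 ^ (card players - 1)"]) (auto simp: banzhaf_def divide_right_mono)
  next
    case False
    \<comment> \<open>For Shapley-Shubik both sides of the shift condition equal 1/537.\<close>
    then show thesis
      using \<Phi> by (intro that[of "\<lambda>k. 1 / (real (card players) * real ((card players - 1) choose (k - 1)))"])
        (auto simp: shapley_shubik_def card_players add.commute)
  qed
  have nonneg: "\<forall>k\<in>{1..537}. 0 \<le> lam k"
    using lam(2) by (simp add: less_imp_le)
  have nonneg': "\<forall>k\<in>{1..card players}. 0 \<le> lam k"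
    using nonneg by (simp add: card_players)
  show VR: "\<Phi> R < \<Phi> VicePresident"
    unfolding lam(1) using vice_president_index_greater[OF assms(2) nonneg _ lam(3)] lam(2) by simp
  show V: "\<Phi> VicePresident < \<Phi> S"
    unfolding lam(1) using senator_index_greater_vice_president[OF assms(1) nonneg] lam(2) by simp
  \<comment> \<open>The chain from the representative upwards makes the senator's index positive,
    hence also the president's, as strict comparison requires.\<close>
  have "0 \<le> \<Phi> R"
    unfolding lam(1) index_of_def using nonneg' by (intro sum_nonneg) auto
  then have "0 < \<Phi> S"
    using VR V by linarith
  moreover have "\<Phi> S \<le> \<Phi> President"
    unfolding lam(1) by (rule weakly_dominates_index_le[OF strictly_dominates_imp_weakly[OF PS] nonneg'])
  ultimately show "\<Phi> S < \<Phi> President"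
    using strictly_dominates_index_less[OF PS nonneg'] unfolding lam(1) by linarith
qed

end
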